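(* Suppose $R\sim\mathcal{M}(sI_{3\times3})$ for $s\ge0$. The probability density of $R$ relative to the uniform distribution on $\mathsf{SO(3)}$ is $$p(R)=\frac{1}{I_0(2s)-I_1(2s)}\exp\big(s\,(\mathrm{tr}[R]-1)\big).$$ For $\theta\in[0,\pi]$, define $$E_\theta=\{R\in\mathsf{SO(3)}\mid\|(\log(R))^\vee\|\le\theta\},$$ which is the set of the rotation matrices that can be obtained from a fixed-axis rotation of $I_{3\times3}$ with a rotation angle less than or equal to $\theta$. The probability that $R$ belongs to $E_\theta$ is $$\mathrm{Prob}[R\in E_\theta]=\frac{1}{\pi(I_0(2s)-I_1(2s))}\int_0^\theta\exp(2s\cos\rho)(1-\cos\rho)\,d\rho.$$
   Context: $\mathsf{SO(3)}=\{R\in\mathbb{R}^{3\times3}\mid R^TR=I_{3\times3},\det R=1\}$ carries the Haar measure $dR$ normalized by $\int_{\mathsf{SO(3)}}dR=1$ (the uniform distribution). For $F\in\mathbb{R}^{3\times3}$, $R\sim\mathcal{M}(F)$ (matrix Fisher distribution) means that $R\in\mathsf{SO(3)}$ has density $p(R)=\frac{1}{c(F)}\exp(\mathrm{tr}[F^TR])$ with respect to $dR$, where $c(F)=\int_{\mathsf{SO(3)}}\exp(\mathrm{tr}[F^TR])\,dR$. The hat map $\wedge:\mathbb{R}^3\to\mathfrak{so}(3)$ sends $x$ to the skew-symmetric matrix $\hat x$ with $\hat xy=x\times y$; its inverse is the vee map $\vee:\mathfrak{so}(3)\to\mathbb{R}^3$. $\log$ is the principal matrix logarithm on $\mathsf{SO(3)}$,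 so that $\|(\log R)^\vee\|\in[0,\pi]$ is the rotation angle of $R$. $I_0(x)=\frac1\pi\int_0^\pi\exp(x\cos\theta)\,d\theta$ and $I_1(x)=\frac1\pi\int_0^\pi\cos\theta\exp(x\cos\theta)\,d\theta$ are modified Bessel functions of the first kind. *)

theory Defs
  imports "HOL-Probability.Probability"
begin

definition SO3 :: "(real^3^3) set" where
  "SO3 = {R. transpose R ** R = mat 1 \<and> det R = 1}"

definition so3 :: "(real^3^3) set" where
  "so3 = {A. transpose A = - A}"

text \<open>The normalized Haar measure is characterized as the left-invariant Borel probability
  measure on the compact group SO(3), where it is unique (and also right-invariant).\<close>

definition haar_SO3 :: "(real^3^3) measure \<Rightarrow> bool" where
  "haar_SO3 \<mu> \<longleftrightarrow>
     prob_space \<mu> \<and> sets \<mu> = sets (restrict_space borel SO3) \<and>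
     (\<forall>Q\<in>SO3. distr \<mu> \<mu> (\<lambda>R. Q ** R) = \<mu>)"

definition fisher_const :: "(real^3^3) measure \<Rightarrow> real^3^3 \<Rightarrow> real" where
  "fisher_const \<mu> F = (\<integral>R. exp (trace (transpose F ** R)) \<partial>\<mu>)"

definition fisher_density :: "(real^3^3) measure \<Rightarrow> real^3^3 \<Rightarrow> real^3^3 \<Rightarrow> real" where
  "fisher_density \<mu> F R = 1 / fisher_const \<mu> F * exp (trace (transpose F ** R))"

definition matrix_fisher ::
  "'w measure \<Rightarrow> (real^3^3) measure \<Rightarrow> ('w \<Rightarrow> real^3^3) \<Rightarrow> real^3^3 \<Rightarrow> bool" where
  "matrix_fisher M \<mu> R F \<longleftrightarrow> distributed M \<mu> R (\<lambda>Q. ennreal (fisher_density \<mu> F Q))"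

definition hat :: "real^3 \<Rightarrow> real^3^3" where
  "hat x = matrix (\<lambda>y. cross3 x y)"

definition vee :: "real^3^3 \<Rightarrow> real^3" where
  "vee = the_inv hat"

definition mexp :: "real^'n^'n \<Rightarrow> real^'n^'n" where
  "mexp A = (\<Sum>k. (1 / fact k) *\<^sub>R (((**) A ^^ k) (mat 1)))"

text \<open>Principal logarithm: the logarithm whose eigenvalues lie in the strip
  \<open>\<bar>Im z\<bar> \<le> \<pi>\<close>. The strip is closed so that rotations by the angle \<open>\<pi>\<close>, which have the
  eigenvalue \<open>-1\<close>, are covered. For these there are two such logarithms in \<open>so3\<close>, which are
  negatives of each other, and an arbitrary one is chosen; otherwise it is unique.\<close>

definition is_principal_log :: "real^3^3 \<Rightarrow> real^3^3 \<Rightarrow> bool" where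
  "is_principal_log R A \<longleftrightarrow>
     A \<in> so3 \<and> mexp A = R \<and>
     (\<forall>z::complex. det (mat z - map_matrix of_real A) = 0 \<longrightarrow> \<bar>Im z\<bar> \<le> pi)"

definition mlog :: "real^3^3 \<Rightarrow> real^3^3" where
  "mlog R = (SOME A. is_principal_log R A)"

definition E_set :: "real \<Rightarrow> (real^3^3) set" where
  "E_set \<theta> = {R \<in> SO3. norm (vee (mlog R)) \<le> \<theta>}"

definition axis_rotation :: "real^3 \<Rightarrow> real \<Rightarrow> real^3^3" where
  "axis_rotation a \<rho> = mexp (\<rho> *\<^sub>R hat a)"

definition bessel_I0 :: "real \<Rightarrow> real" where
  "bessel_I0 x = 1 / pi * integral {0..pi} (\<lambda>\<theta>. exp (x * cos \<theta>))"

definition bessel_I1 :: "real \<Rightarrow> real" where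
  "bessel_I1 x = 1 / pi * integral {0..pi} (\<lambda>\<theta>. cos \<theta> * exp (x * cos \<theta>))"

end

theory Submission
  imports Defs
begin

text \<open>
  Every rotation is a rotation about some axis by an angle in \<open>[0, pi]\<close> (\<open>SO3_eq_rodrigues\<close>), and its trace is
  \<open>1 + 2 cos \<theta>\<close>. A principal logarithm is \<open>\<theta> *\<^sub>R hat a\<close> for a unit axis \<open>a\<close>, so \<open>E_set \<theta>\<close> consists of the
  rotations with angle at most \<open>\<theta>\<close>, which is the condition \<open>cos_angle Q \<ge> cos \<theta>\<close> on the trace. The
  Fisher density with parameter \<open>s *\<^sub>R mat 1\<close> is also a function of the trace. All claims therefore
  follow once the law of the rotation angle under the Haar measure is known to have the density
  \<open>(1 - cos \<rho>) / pi\<close> on \<open>[0, pi]\<close> (\<open>haar_angle_distribution\<close>); the normalizing constant is then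
  \<open>exp s\<close> times \<open>1/pi\<close> times the integral of \<open>exp (2 s cos \<rho>) (1 - cos \<rho>)\<close>, a difference of two
  Bessel integrals.

  The law is obtained from left invariance alone, without coordinates on the group and without a
  construction of the Haar measure. Differentiating along the rotations about an axis shows that
  derivatives integrate to 0 (\<open>haar_integral_derivative\<close>). For the functions \<open>c ^ n * trace (hat a ** Q)\<close>,
  where \<open>c = cos_angle Q\<close> is the cosine of the angle, the sum of these identities over three orthogonal
  axes involves \<open>c\<close> only: it states that the expectation of \<open>n c ^ (n - 1) (1 - c\<^sup>2) - (1 + 2 c) c ^ n\<close>
  vanishes. This recursion determines all moments of \<open>c\<close>, and integration by parts gives
  the same recursion for \<open>cos \<rho>\<close> under the density \<open>(1 - cos \<rho>) / pi\<close>
  (\<open>haar_moment_recursion\<close>, \<open>angle_moment_recursion\<close>). Bounded random variables with equal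
  moments have equal laws (\<open>moments_determine_distribution\<close>).
\<close>

section \<open>Rotations and the hat map\<close>

lemma mat3_eq_iff:
  fixes A B :: "real^3^3"
  shows "A = B \<longleftrightarrow> A$1$1 = B$1$1 \<and> A$1$2 = B$1$2 \<and> A$1$3 = B$1$3 \<and>
    A$2$1 = B$2$1 \<and> A$2$2 = B$2$2 \<and> A$2$3 = B$2$3 \<and>
    A$3$1 = B$3$1 \<and> A$3$2 = B$3$2 \<and> A$3$3 = B$3$3"
  by (auto simp: vec_eq_iff forall_3)

lemma trace_3: "trace (A::real^3^3) = A$1$1 + A$2$2 + A$3$3"
  by (simp add: trace_def sum_3)

lemma SO3_iff_rotation: "Q \<in> SO3 \<longleftrightarrow> rotation_matrix Q"
  by (simp add: SO3_def rotation_matrix_def orthogonal_matrix)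

lemma SO3_mult: "P \<in> SO3 \<Longrightarrow> Q \<in> SO3 \<Longrightarrow> P ** Q \<in> SO3"
  by (simp add: SO3_iff_rotation rotation_matrix_def orthogonal_matrix_mul det_mul)

lemma SO3_transpose: "Q \<in> SO3 \<Longrightarrow> transpose Q \<in> SO3"
  by (simp add: SO3_iff_rotation rotation_matrix_def orthogonal_matrix_transpose det_transpose)

lemma SO3_times_transpose: "Q \<in> SO3 \<Longrightarrow> Q ** transpose Q = mat 1"
  by (simp add: SO3_iff_rotation rotation_matrix_def orthogonal_matrix_def)

lemma SO3_transpose_times: "Q \<in> SO3 \<Longrightarrow> transpose Q ** Q = mat 1"
  by (simp add: SO3_def)

lemma SO3_cross: "Q \<in> SO3 \<Longrightarrow> cross3 (Q *v x) (Q *v y) = Q *v (cross3 x y)"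
  by (simp add: SO3_iff_rotation cross_rotation_matrix)

text \<open>The adjugate of a rotation is its transpose, so its principal minors are its diagonal entries.
  Consequently the sum of the principal minors equals the trace, which is what turns identities for
  \<open>SO3\<close> into polynomial identities in the trace alone.\<close>
lemma SO3_minors:
  assumes "Q \<in> SO3"
  shows "Q$2$2 * Q$3$3 - Q$2$3 * Q$3$2 = Q$1$1"
    and "Q$1$1 * Q$3$3 - Q$1$3 * Q$3$1 = Q$2$2"
    and "Q$1$1 * Q$2$2 - Q$1$2 * Q$2$1 = Q$3$3"
proof -
  have a: "cross3 (column i Q) (column j Q) $ k = (Q *v (cross3 (axis i 1) (axis j 1))) $ k" for i j k
    using SO3_cross[OF assms, of "axis i 1" "axis j 1"] by (simp add: matrix_vector_mult_basis)
  show "Q$2$2 * Q$3$3 - Q$2$3 * Q$3$2 = Q$1$1"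
    using a[of 2 3 1] unfolding cross_basis matrix_vector_mult_basis
    by (simp add: cross3_def column_def mult.commute)
  show "Q$1$1 * Q$3$3 - Q$1$3 * Q$3$1 = Q$2$2"
    using a[of 3 1 2] unfolding cross_basis matrix_vector_mult_basis
    by (simp add: cross3_def column_def mult.commute)
  show "Q$1$1 * Q$2$2 - Q$1$2 * Q$2$1 = Q$3$3"
    using a[of 1 2 3] unfolding cross_basis matrix_vector_mult_basis
    by (simp add: cross3_def column_def mult.commute)
qed

lemma hat_components:
  "hat x $1$1 = 0" "hat x $1$2 = - x$3" "hat x $1$3 = x$2"
  "hat x $2$1 = x$3" "hat x $2$2 = 0" "hat x $2$3 = - x$1"
  "hat x $3$1 = - x$2" "hat x $3$2 = x$1" "hat x $3$3 = 0"
  by (simp_all add: hat_def matrix_def cross3_def axis_def)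

lemma hat_mult_vec: "hat x *v y = cross3 x y"
  by (simp add: vec_eq_iff forall_3 matrix_vector_mult_def sum_3 hat_components cross3_def)

lemma hat_scaleR: "hat (c *\<^sub>R x) = c *\<^sub>R hat x"
  by (simp add: mat3_eq_iff hat_components)

lemma inj_hat: "inj hat"
  by (rule injI) (simp add: mat3_eq_iff hat_components vec_eq_iff forall_3)

lemma vee_hat: "vee (hat x) = x"
  unfolding vee_def by (rule the_inv_f_f[OF inj_hat])

lemma so3_iff_hat: "A \<in> so3 \<longleftrightarrow> (\<exists>x. A = hat x)"
proof
  assume "A \<in> so3"
  then have skew: "transpose A $ j $ i = (- A) $ j $ i" for i j by (simp add: so3_def)
  have "A$i$j = - A$j$i" for i j
    using skew[where i=i and j=j] unfolding transpose_def vec_lambda_beta vector_uminus_component .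
  then have "A$1$1 = 0" "A$2$2 = 0" "A$3$3 = 0" "A$1$2 = - A$2$1" "A$2$3 = - A$3$2" "A$3$1 = - A$1$3"
    by (metis equal_neg_zero)+
  then have "A = hat (vector [A$3$2, A$1$3, A$2$1])"
    unfolding mat3_eq_iff hat_components by simp
  then show "\<exists>x. A = hat x" ..
next
  assume "\<exists>x. A = hat x"
  then obtain x where "A = hat x" ..
  then show "A \<in> so3"
    unfolding so3_def mem_Collect_eq mat3_eq_iff by (simp add: transpose_def hat_components)
qed

lemma norm_sq_3: "(norm (x::real^3))\<^sup>2 = (x$1)\<^sup>2 + (x$2)\<^sup>2 + (x$3)\<^sup>2"
  unfolding power2_norm_eq_inner by (simp add: inner_vec_def sum_3 power2_eq_square)

lemma hat_cube:
  assumes "norm a = 1"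
  shows "hat a ** (hat a ** hat a) = - hat a"
proof -
  have n: "(a$1)\<^sup>2 + (a$2)\<^sup>2 + (a$3)\<^sup>2 = 1"
    using norm_sq_3[of a] assms by simp
  have 1: "hat a ** (hat a ** hat a) = - (((a$1)\<^sup>2 + (a$2)\<^sup>2 + (a$3)\<^sup>2) *\<^sub>R hat a)"
    by (simp add: mat3_eq_iff matrix_matrix_mult_def sum_3 hat_components power2_eq_square algebra_simps)
  show ?thesis unfolding 1 n by simp
qed

lemma hat_conj:
  assumes "Q \<in> SO3"
  shows "Q ** hat x ** transpose Q = hat (Q *v x)"
proof -
  have "(Q ** hat x ** transpose Q) *v y = hat (Q *v x) *v y" for y
  proof -
    have "Q *v (cross3 x (transpose Q *v y)) = cross3 (Q *v x) (Q *v (transpose Q *v y))"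
      using SO3_cross[OF assms] by simp
    also have "Q *v (transpose Q *v y) = y"
      by (simp only: matrix_vector_mul_assoc SO3_times_transpose[OF assms] matrix_vector_mul_lid)
    finally show ?thesis by (simp only: matrix_vector_mul_assoc[symmetric] hat_mult_vec)
  qed
  then show ?thesis by (simp add: matrix_eq)
qed

lemma matrix_linear_right:
  fixes A B C :: "real^3^3"
  shows "A ** (B + C) = A ** B + A ** C" "A ** (B - C) = A ** B - A ** C"
    "A ** (c *\<^sub>R B) = c *\<^sub>R (A ** B)" "A ** (- B) = - (A ** B)"
  by (simp_all add: mat3_eq_iff matrix_matrix_mult_def sum_3 algebra_simps)

lemma matrix_linear_left:
  fixes A B C :: "real^3^3"
  shows "(B + C) ** A = B ** A + C ** A" "(c *\<^sub>R B) ** A = c *\<^sub>R (B ** A)"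
    "(- B) ** A = - (B ** A)"
  by (simp_all add: mat3_eq_iff matrix_matrix_mult_def sum_3 algebra_simps)

section \<open>Rodrigues' formula and Euler's rotation theorem\<close>

text \<open>The rotation by the angle \<open>t\<close> about the unit axis \<open>a\<close>, by Rodrigues' formula.\<close>
definition rodrigues :: "real^3 \<Rightarrow> real \<Rightarrow> real^3^3" where
  "rodrigues a t = mat 1 + sin t *\<^sub>R hat a + (1 - cos t) *\<^sub>R (hat a ** hat a)"

text \<open>Since the cube of \<open>hat a\<close> is its negative, the powers of \<open>hat a\<close> alternate up to sign between
  \<open>hat a\<close> and its square, in the pattern of the coefficients of sine and cosine. The identity
  breaks down at exponent 0, where the power is \<open>mat 1\<close>; this is why Rodrigues' formula contains
  \<open>1 - cos t\<close> instead of \<open>- cos t\<close>.\<close>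
lemma hat_power:
  assumes "norm a = 1" and "k \<ge> 1"
  shows "((**) (\<rho> *\<^sub>R hat a) ^^ k) (mat 1) =
    (fact k * \<rho> ^ k) *\<^sub>R (sin_coeff k *\<^sub>R hat a - cos_coeff k *\<^sub>R (hat a ** hat a))"
  using assms(2)
proof (induction k rule: dec_induct)
  case base
  show ?case by (simp add: sin_coeff_def cos_coeff_def)
next
  case (step k)
  have "hat a ** (sin_coeff k *\<^sub>R hat a - cos_coeff k *\<^sub>R (hat a ** hat a))
      = real (Suc k) *\<^sub>R (sin_coeff (Suc k) *\<^sub>R hat a - cos_coeff (Suc k) *\<^sub>R (hat a ** hat a))"
    by (simp add: matrix_linear_right hat_cube[OF assms(1)]
        sin_coeff_Suc cos_coeff_Suc scaleR_add_right del: of_nat_Suc)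
  then show ?case using step
    by (simp add: matrix_linear_right matrix_linear_left mult_ac)
qed

lemma mexp_rodrigues:
  assumes "norm a = 1"
  shows "mexp (\<rho> *\<^sub>R hat a) = rodrigues a \<rho>"
proof -
  let ?H = "hat a" and ?H2 = "hat a ** hat a"
  have "(\<lambda>k. (if k = 0 then mat 1 + ?H2 else 0) +
      ((sin_coeff k *\<^sub>R \<rho> ^ k) *\<^sub>R ?H - (cos_coeff k *\<^sub>R \<rho> ^ k) *\<^sub>R ?H2))
    sums ((mat 1 + ?H2) + (sin \<rho> *\<^sub>R ?H - cos \<rho> *\<^sub>R ?H2))"
    by (intro sums_add sums_diff bounded_linear.sums[OF bounded_linear_scaleR_left]
        sin_converges cos_converges sums_single)
  also have "(\<lambda>k. (if k = 0 then mat 1 + ?H2 else 0) +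
      ((sin_coeff k *\<^sub>R \<rho> ^ k) *\<^sub>R ?H - (cos_coeff k *\<^sub>R \<rho> ^ k) *\<^sub>R ?H2))
     = (\<lambda>k. (1 / fact k) *\<^sub>R (((**) (\<rho> *\<^sub>R ?H) ^^ k) (mat 1)))"
  proof
    fix k show "(if k = 0 then mat 1 + ?H2 else 0) +
      ((sin_coeff k *\<^sub>R \<rho> ^ k) *\<^sub>R ?H - (cos_coeff k *\<^sub>R \<rho> ^ k) *\<^sub>R ?H2)
     = (1 / fact k) *\<^sub>R (((**) (\<rho> *\<^sub>R ?H) ^^ k) (mat 1))"
      using hat_power[OF assms, of k \<rho>]
      by (cases "k = 0") (simp_all add: scaleR_diff_right mult_ac)
  qed
  finally show ?thesis
    unfolding mexp_def rodrigues_def by (simp add: sums_unique[symmetric] algebra_simps)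
qed

lemma trace_rodrigues:
  assumes "norm a = 1"
  shows "trace (rodrigues a t) = 1 + 2 * cos t"
proof -
  have n: "(a$1)\<^sup>2 + (a$2)\<^sup>2 + (a$3)\<^sup>2 = 1"
    using norm_sq_3[of a] assms by simp
  have "trace (rodrigues a t) = 3 - 2 * (1 - cos t) * ((a$1)\<^sup>2 + (a$2)\<^sup>2 + (a$3)\<^sup>2)"
    by (simp add: trace_3 rodrigues_def matrix_matrix_mult_def sum_3 hat_components mat_def
        power2_eq_square algebra_simps)
  then show ?thesis unfolding n by simp
qed

lemma rodrigues_conj:
  assumes "Q \<in> SO3"
  shows "Q ** rodrigues a t ** transpose Q = rodrigues (Q *v a) t"
proof -
  have "Q ** (hat a ** hat a) ** transpose Q
      = (Q ** hat a ** (transpose Q ** Q)) ** hat a ** transpose Q"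
    unfolding SO3_transpose_times[OF assms] by (simp add: matrix_mul_assoc)
  also have "\<dots> = hat (Q *v a) ** hat (Q *v a)"
    by (simp add: matrix_mul_assoc flip: hat_conj[OF assms])
  finally show ?thesis using SO3_times_transpose[OF assms] hat_conj[OF assms, of a]
    by (simp add: rodrigues_def matrix_linear_right matrix_linear_left)
qed

lemma rodrigues_axis1:
  "rodrigues (axis 1 1) t = vector [vector [1,0,0], vector [0, cos t, - sin t], vector [0, sin t, cos t]]"
  by (simp add: mat3_eq_iff rodrigues_def matrix_matrix_mult_def sum_3 hat_components mat_def axis_def)

lemma obtain_frame:
  assumes "norm (a::real^3) = 1"
  obtains Q where "Q \<in> SO3" "Q *v (axis 1 1) = a"
  using rotation_matrix_exists_basis[of a 1] assms by (auto simp: SO3_iff_rotation)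

text \<open>A rotation that moves the first basis vector to \<open>a\<close> conjugates the explicit rotation about the
  first basis vector to the one about \<open>a\<close>.\<close>
lemma rodrigues_in_SO3:
  assumes "norm a = 1"
  shows "rodrigues a t \<in> SO3"
proof -
  obtain Q where Q: "Q \<in> SO3" "Q *v (axis 1 1) = a" using obtain_frame[OF assms] .
  have "rodrigues (axis 1 1) t \<in> SO3"
    using sin_cos_squared_add[of t]
    by (simp add: SO3_def rodrigues_axis1 mat3_eq_iff matrix_matrix_mult_def transpose_def sum_3
        mat_def det_3 power2_eq_square algebra_simps)
  then show ?thesis
    using rodrigues_conj[OF Q(1), of "axis 1 1" t] Q by (metis SO3_mult SO3_transpose)
qed

lemma rodrigues_minus: "rodrigues (- a) t = rodrigues a (- t)"
  using hat_scaleR[of "-1" a] by (simp add: rodrigues_def mat3_eq_iff matrix_matrix_mult_def sum_3)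

text \<open>Euler's rotation theorem: the value of the characteristic polynomial at 1 is, up to sign,
  \<open>det Q\<close> minus the sum of the principal minors plus the trace minus 1; the middle terms cancel by
  the lemma on minors.\<close>
lemma SO3_fixes_unit_vector:
  assumes "Q \<in> SO3"
  obtains a where "norm a = 1" "Q *v a = a"
proof -
  have "det (Q - mat 1) = det Q - (Q$2$2 * Q$3$3 - Q$2$3 * Q$3$2) - (Q$1$1 * Q$3$3 - Q$1$3 * Q$3$1)
      - (Q$1$1 * Q$2$2 - Q$1$2 * Q$2$1) + Q$1$1 + Q$2$2 + Q$3$3 - 1"
    by (simp add: det_3 mat_def algebra_simps)
  also have "\<dots> = 0" using assms unfolding SO3_minors[OF assms] by (simp add: SO3_def)
  finally have "\<not> invertible (Q - mat 1)" by (simp add: invertible_det_nz)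
  then obtain x where x: "(Q - mat 1) *v x = 0" "x \<noteq> 0"
    using matrix_left_invertible_ker invertible_left_inverse by metis
  then have "Q *v x = x" by (simp add: matrix_vector_mult_diff_rdistrib)
  then have "norm (x /\<^sub>R norm x) = 1" "Q *v (x /\<^sub>R norm x) = x /\<^sub>R norm x"
    using x by (simp_all add: matrix_vector_mult_scaleR)
  then show thesis by (rule that)
qed

text \<open>In a positively oriented orthonormal frame that starts with a fixed vector, the rotation has a
  planar rotation as its remaining block. If the planar angle is negative, reversing the axis makes
  it lie in \<open>[0, pi]\<close>.\<close>
lemma SO3_eq_rodrigues:
  assumes "Q \<in> SO3"
  obtains a t where "norm a = 1" "0 \<le> t" "t \<le> pi" "Q = rodrigues a t"
proof -
  obtain a where a: "norm a = 1" "Q *v a = a" using SO3_fixes_unit_vector[OF assms] .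
  obtain P where P: "P \<in> SO3" "P *v (axis 1 1) = a" using obtain_frame[OF a(1)] .
  define N where "N = transpose P ** Q ** P"
  have N: "N \<in> SO3" using P assms by (simp add: N_def SO3_mult SO3_transpose)
  have Q: "Q = P ** N ** transpose P"
    using SO3_times_transpose[OF P(1)]
    by (simp add: N_def matrix_mul_assoc) (simp flip: matrix_mul_assoc)
  have "transpose P *v a = axis 1 1"
    by (simp add: P(2)[symmetric] matrix_vector_mul_assoc SO3_transpose_times[OF P(1)])
  then have "N *v axis 1 1 = axis 1 1"
    by (simp add: N_def P a flip: matrix_vector_mul_assoc)
  then have col: "N$1$1 = 1" "N$2$1 = 0" "N$3$1 = 0"
    by (simp_all add: matrix_vector_mult_basis column_def)
      (simp_all add: vec_eq_iff forall_3 axis_def)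
  have "N$1$1 * N$1$1 + N$1$2 * N$1$2 + N$1$3 * N$1$3 = 1"
    "N$2$1 * N$3$1 + N$2$2 * N$3$2 + N$2$3 * N$3$3 = 0"
    "N$2$1 * N$2$1 + N$2$2 * N$2$2 + N$2$3 * N$2$3 = 1"
    using SO3_times_transpose[OF N]
    by (simp_all add: mat3_eq_iff matrix_matrix_mult_def transpose_def sum_3 mat_def)
  note rows = this[unfolded col]
  have row: "N$1$2 = 0" "N$1$3 = 0"
    using rows(1) by (simp_all add: sum_squares_eq_zero_iff)
  have diag: "N$3$3 = N$2$2" using SO3_minors(2)[OF N] col row by simp
  have one: "(N$2$2)\<^sup>2 + (N$2$3)\<^sup>2 = 1" using rows(3) by (simp add: power2_eq_square)
  have "N$2$2 * N$2$2 - N$2$3 * N$3$2 = 1" using SO3_minors(1)[OF N] col diag by simp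
  then have off: "N$3$2 = - N$2$3"
    using rows(2,3) diag by algebra
  have "(N$2$2)\<^sup>2 + \<bar>N$2$3\<bar>\<^sup>2 = 1" using one by simp
  then obtain t where t: "0 \<le> t" "t \<le> pi" "N$2$2 = cos t" "\<bar>N$2$3\<bar> = sin t"
    using sincos_total_pi[of "\<bar>N$2$3\<bar>" "N$2$2"] by auto
  show thesis
  proof (cases "N$2$3 \<le> 0")
    case True
    then have "N = rodrigues (axis 1 1) t"
      using t col row diag off by (simp add: mat3_eq_iff rodrigues_axis1)
    then have "Q = rodrigues a t" using Q rodrigues_conj[OF P(1)] P(2) by simp
    then show thesis using that a t by blast
  next
    case False
    then have "N = rodrigues (axis 1 1) (- t)"
      using t col row diag off by (simp add: mat3_eq_iff rodrigues_axis1)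
    then have "Q = rodrigues (- a) t" using Q rodrigues_conj[OF P(1)] P(2)
      by (simp add: rodrigues_minus)
    then show thesis using that[of "- a" t] a t by simp
  qed
qed

section \<open>The principal logarithm\<close>

text \<open>The eigenvalues of \<open>hat x\<close> are 0 and \<open>\<plusminus>\<i> norm x\<close>; hence the condition on the eigenvalues of a
  principal logarithm is a bound on the rotation angle.\<close>
lemma det_char_hat:
  "det (mat z - map_matrix of_real (hat x)) = z ^ 3 + of_real ((norm x)\<^sup>2) * (z::complex)"
  unfolding norm_sq_3
  by (simp add: det_3 mat_def hat_components power2_eq_square power3_eq_cube algebra_simps)

lemma hat_eigenvalues_in_strip:
  "(\<forall>z::complex. det (mat z - map_matrix of_real (hat x)) = 0 \<longrightarrow> \<bar>Im z\<bar> \<le> pi) \<longleftrightarrow> norm x \<le> pi"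
proof
  assume *: "\<forall>z::complex. det (mat z - map_matrix of_real (hat x)) = 0 \<longrightarrow> \<bar>Im z\<bar> \<le> pi"
  have "(\<i> * norm x) ^ 3 + of_real ((norm x)\<^sup>2) * (\<i> * norm x)
      = (\<i> * norm x) * ((\<i> * norm x)\<^sup>2 + of_real ((norm x)\<^sup>2))"
    by (simp only: power2_eq_square power3_eq_cube algebra_simps)
  also have "\<dots> = 0" by (simp add: power_mult_distrib)
  finally have "det (mat (\<i> * norm x) - map_matrix of_real (hat x)) = (0::complex)"
    unfolding det_char_hat .
  then have "\<bar>Im (\<i> * norm x)\<bar> \<le> pi" using * by blast
  then show "norm x \<le> pi" by simp
next
  assume n: "norm x \<le> pi"
  show "\<forall>z::complex. det (mat z - map_matrix of_real (hat x)) = 0 \<longrightarrow> \<bar>Im z\<bar> \<le> pi"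
  proof (intro allI impI)
    fix z :: complex assume "det (mat z - map_matrix of_real (hat x)) = 0"
    moreover have "z ^ 3 + of_real ((norm x)\<^sup>2) * z = z * (z\<^sup>2 - (\<i> * norm x)\<^sup>2)"
      by (simp add: power_mult_distrib power2_eq_square power3_eq_cube distrib_left mult_ac)
    ultimately have "z * (z\<^sup>2 - (\<i> * norm x)\<^sup>2) = 0"
      unfolding det_char_hat by simp
    then have "z = 0 \<or> z = \<i> * norm x \<or> z = - (\<i> * norm x)"
      by (simp add: power2_eq_iff)
    then show "\<bar>Im z\<bar> \<le> pi" using n by auto
  qed
qed

lemma is_principal_log_hat: "is_principal_log Q (hat x) \<longleftrightarrow> mexp (hat x) = Q \<and> norm x \<le> pi"
  unfolding is_principal_log_def hat_eigenvalues_in_strip by (auto simp: so3_iff_hat)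

text \<open>Whichever principal logarithm is chosen, its norm is an angle in \<open>[0, pi]\<close> whose cosine is
  determined by the trace, and the cosine is injective there. So the ambiguity at the angle
  \<open>pi\<close> does no harm.\<close>
lemma norm_vee_mlog_rodrigues:
  assumes "norm a = 1" "0 \<le> t" "t \<le> pi"
  shows "norm (vee (mlog (rodrigues a t))) = t"
proof -
  let ?Q = "rodrigues a t"
  have "is_principal_log ?Q (hat (t *\<^sub>R a))"
    unfolding is_principal_log_hat using assms mexp_rodrigues[OF assms(1), of t]
    by (simp add: hat_scaleR)
  then have log: "is_principal_log ?Q (mlog ?Q)" unfolding mlog_def by (rule someI)
  then obtain x where x: "mlog ?Q = hat x" by (auto simp: is_principal_log_def so3_iff_hat)
  then have *: "mexp (hat x) = ?Q" "norm x \<le> pi" using log by (simp_all add: is_principal_log_hat)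
  \<comment> \<open>For \<open>x = 0\<close> any unit vector serves as the axis.\<close>
  obtain b where b: "norm b = 1" "norm x *\<^sub>R b = x"
  proof (cases "x = 0")
    case True then show ?thesis using that[of "axis 1 1"] by simp
  next
    case False then show ?thesis using that[of "x /\<^sub>R norm x"] by simp
  qed
  have "rodrigues b (norm x) = ?Q"
    using *(1) by (simp add: b(2) flip: mexp_rodrigues[OF b(1)] hat_scaleR)
  then have "cos (norm x) = cos t"
    using trace_rodrigues[OF b(1), of "norm x"] trace_rodrigues[OF assms(1), of t] by simp
  then have "norm x = t" using cos_inj_pi[of "norm x" t] *(2) assms by simp
  then show ?thesis by (simp add: x vee_hat)
qed

lemma E_set_eq_axis_rotations:
  assumes "0 \<le> \<theta>" "\<theta> \<le> pi"
  shows "E_set \<theta> = {axis_rotation a \<rho> | a \<rho>. norm a = 1 \<and> 0 \<le> \<rho> \<and> \<rho> \<le> \<theta>}"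
proof (intro set_eqI iffI)
  fix Q assume "Q \<in> E_set \<theta>"
  then have Q: "Q \<in> SO3" "norm (vee (mlog Q)) \<le> \<theta>" by (auto simp: E_set_def)
  obtain a t where a: "norm a = 1" "0 \<le> t" "t \<le> pi" "Q = rodrigues a t"
    using SO3_eq_rodrigues[OF Q(1)] .
  then have "Q = axis_rotation a t" "t \<le> \<theta>"
    using Q(2) norm_vee_mlog_rodrigues[OF a(1-3)] mexp_rodrigues[OF a(1), of t]
    by (simp_all add: axis_rotation_def)
  then show "Q \<in> {axis_rotation a \<rho> | a \<rho>. norm a = 1 \<and> 0 \<le> \<rho> \<and> \<rho> \<le> \<theta>}"
    using a(1,2) by blast
next
  fix Q assume "Q \<in> {axis_rotation a \<rho> | a \<rho>. norm a = 1 \<and> 0 \<le> \<rho> \<and> \<rho> \<le> \<theta>}"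
  then obtain a t where "norm a = 1" "0 \<le> t" "t \<le> \<theta>" "Q = rodrigues a t"
    by (auto simp: axis_rotation_def mexp_rodrigues)
  then show "Q \<in> E_set \<theta>"
    using assms norm_vee_mlog_rodrigues[of a t] by (auto simp: E_set_def rodrigues_in_SO3)
qed

definition cos_angle :: "real^3^3 \<Rightarrow> real" where
  "cos_angle Q = (trace Q - 1) / 2"

lemma E_set_iff_cos_angle:
  assumes "0 \<le> \<theta>" "\<theta> \<le> pi" "Q \<in> SO3"
  shows "Q \<in> E_set \<theta> \<longleftrightarrow> cos \<theta> \<le> cos_angle Q"
proof -
  obtain a t where a: "norm a = 1" "0 \<le> t" "t \<le> pi" "Q = rodrigues a t"
    using SO3_eq_rodrigues[OF assms(3)] .
  then show ?thesis
    using assms norm_vee_mlog_rodrigues[OF a(1-3)]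
    by (simp add: E_set_def cos_angle_def trace_rodrigues cos_mono_le_eq)
qed

lemma abs_cos_angle_le_1:
  assumes "Q \<in> SO3"
  shows "\<bar>cos_angle Q\<bar> \<le> 1"
proof -
  obtain a t where "norm a = 1" "0 \<le> t" "t \<le> pi" "Q = rodrigues a t"
    using SO3_eq_rodrigues[OF assms] .
  then show ?thesis by (simp add: cos_angle_def trace_rodrigues)
qed

section \<open>Invariance of the Haar measure\<close>

lemma trace_linear:
  fixes A B :: "real^3^3"
  shows "trace (A + B) = trace A + trace B" "trace (- A) = - trace A" "trace (c *\<^sub>R A) = c * trace A"
  by (simp_all add: trace_3 algebra_simps)

lemma compact_SO3: "compact SO3"
proof -
  have "norm Q \<le> 3" if "Q \<in> SO3" for Q
  proof -
    have "(norm (Q$i))\<^sup>2 = (Q ** transpose Q)$i$i" for i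
      unfolding norm_sq_3
      by (simp add: matrix_matrix_mult_def transpose_def sum_3 power2_eq_square)
    then have "(norm (Q$i))\<^sup>2 = 1" for i
      unfolding SO3_times_transpose[OF that] by (simp add: mat_def)
    then have "norm (Q$i) = 1" for i
      using abs_square_eq_1[of "norm (Q$i)"] by simp
    then show ?thesis
      using L2_set_le_sum[of UNIV "\<lambda>i. norm (Q$i)"] by (simp add: norm_vec_def sum_3)
  qed
  then have "bounded SO3" by (auto simp: bounded_iff)
  moreover have "closed SO3"
    unfolding SO3_def mat3_eq_iff transpose_def matrix_matrix_mult_def det_3 sum_3
    by (simp, intro closed_Collect_conj closed_Collect_eq continuous_intros)
  ultimately show ?thesis by (simp add: compact_eq_bounded_closed)
qed

lemma continuous_trace [continuous_intros]:
  fixes f :: "'a::topological_space \<Rightarrow> real^3^3"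
  shows "continuous_on S f \<Longrightarrow> continuous_on S (\<lambda>x. trace (f x))"
  unfolding trace_3 by (intro continuous_intros)

lemma continuous_matrix_mult_left [continuous_intros]:
  fixes f :: "'a::topological_space \<Rightarrow> real^3^3" and A :: "real^3^3"
  shows "continuous_on S f \<Longrightarrow> continuous_on S (\<lambda>x. A ** f x)"
  unfolding matrix_matrix_mult_def by (intro continuous_intros)

lemma continuous_cos_angle [continuous_intros]:
  "continuous_on S f \<Longrightarrow> continuous_on S (\<lambda>x. cos_angle (f x))"
  unfolding cos_angle_def by (intro continuous_intros) auto

lemma borel_measurable_cos_angle [measurable]: "cos_angle \<in> borel_measurable borel"
  by (intro borel_measurable_continuous_onI continuous_intros)

context
  fixes \<mu> :: "(real^3^3) measure"
  assumes haar: "haar_SO3 \<mu>"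
begin

lemma haar_prob_space: "prob_space \<mu>"
  using haar by (simp add: haar_SO3_def)

lemma space_haar: "space \<mu> = SO3"
  using haar sets_eq_imp_space_eq[of \<mu> "restrict_space borel SO3"]
  by (simp add: haar_SO3_def space_restrict_space)

lemma haar_measurable: "f \<in> measurable borel N \<Longrightarrow> f \<in> measurable \<mu> N"
  using haar by (subst measurable_cong_sets[of _ "restrict_space borel SO3" _ N])
    (auto simp: haar_SO3_def intro: measurable_restrict_space1)

lemma haar_left_mult_measurable:
  assumes "Q \<in> SO3"
  shows "(\<lambda>P. Q ** P) \<in> measurable \<mu> \<mu>"
proof -
  have "(\<lambda>P. Q ** P) \<in> measurable borel (borel :: (real^3^3) measure)"
    by (intro borel_measurable_continuous_onI continuous_intros)
  then have "(\<lambda>P. Q ** P) \<in> measurable \<mu> (restrict_space borel SO3)"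
    using assms by (intro measurable_restrict_space2 haar_measurable)
      (auto simp: space_haar SO3_mult)
  then show ?thesis
    using haar by (subst measurable_cong_sets[of _ \<mu> _ "restrict_space borel SO3"]) 
      (auto simp: haar_SO3_def)
qed

lemma haar_integral_left_mult:
  fixes F :: "real^3^3 \<Rightarrow> real"
  assumes "Q \<in> SO3" and "F \<in> borel_measurable borel"
  shows "(\<integral>P. F (Q ** P) \<partial>\<mu>) = (\<integral>P. F P \<partial>\<mu>)"
proof -
  have "distr \<mu> \<mu> (\<lambda>P. Q ** P) = \<mu>"
    using haar assms(1) by (simp add: haar_SO3_def)
  then have "(\<integral>P. F P \<partial>\<mu>) = (\<integral>P. F P \<partial>distr \<mu> \<mu> (\<lambda>P. Q ** P))" by simp
  also have "\<dots> = (\<integral>P. F (Q ** P) \<partial>\<mu>)"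
    by (intro integral_distr haar_left_mult_measurable haar_measurable assms)
  finally show ?thesis ..
qed

lemma haar_integrable:
  fixes F :: "real^3^3 \<Rightarrow> real"
  assumes "continuous_on UNIV F"
  shows "integrable \<mu> F"
proof -
  interpret prob_space \<mu> by (rule haar_prob_space)
  have "bounded (F ` SO3)"
    using assms compact_SO3
    by (intro compact_imp_bounded compact_continuous_image) (auto intro: continuous_on_subset)
  then obtain B where "\<And>Q. Q \<in> SO3 \<Longrightarrow> norm (F Q) \<le> B" by (auto simp: bounded_iff)
  then show ?thesis
    using assms by (intro integrable_const_bound[where B=B] haar_measurable
        borel_measurable_continuous_onI AE_I2) (auto simp: space_haar)
qed

text \<open>Infinitesimal form of invariance: the integral of \<open>F (rodrigues a t ** Q)\<close> over \<open>Q\<close> does not depend on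
  \<open>t\<close>, so its derivative at 0, which is the integral of \<open>G\<close>, vanishes. Differentiation under the
  integral sign is justified by dominated convergence of the difference quotients: by the mean value
  theorem each is a value of \<open>G\<close> on the compact set \<open>SO3\<close>.\<close>
lemma haar_integral_derivative:
  fixes F G :: "real^3^3 \<Rightarrow> real"
  assumes a: "norm a = 1" and F: "continuous_on UNIV F" and G: "continuous_on UNIV G"
    and deriv: "\<And>Q t. Q \<in> SO3 \<Longrightarrow>
      ((\<lambda>t. F (rodrigues a t ** Q)) has_real_derivative G (rodrigues a t ** Q)) (at t)"
  shows "(\<integral>Q. G Q \<partial>\<mu>) = 0"
proof -
  interpret prob_space \<mu> by (rule haar_prob_space)
  have "bounded (G ` SO3)"
    using G compact_SO3
    by (intro compact_imp_bounded compact_continuous_image) (auto intro: continuous_on_subset)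
  then obtain B where B: "\<And>Q. Q \<in> SO3 \<Longrightarrow> \<bar>G Q\<bar> \<le> B" by (auto simp: bounded_iff)
  define h where "h n = inverse (real (Suc n))" for n
  have h: "h n > 0" for n by (simp add: h_def)
  have rot0: "rodrigues a 0 ** Q = Q" for Q by (simp add: rodrigues_def)
  define S where "S n Q = (F (rodrigues a (h n) ** Q) - F Q) / h n" for n Q
  have contF: "continuous_on UNIV (\<lambda>Q. F (P ** Q))" for P :: "real^3^3"
    by (rule continuous_on_compose2[OF F continuous_matrix_mult_left[OF continuous_on_id]]) simp
  have contS: "continuous_on UNIV (S n)" for n
    unfolding S_def using h[of n] by (intro continuous_intros contF F) auto
  have "(\<lambda>n. \<integral>Q. S n Q \<partial>\<mu>) \<longlonglongrightarrow> (\<integral>Q. G Q \<partial>\<mu>)"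
  proof (rule integral_dominated_convergence[where w="\<lambda>_. B"])
    show "G \<in> borel_measurable \<mu>" "\<And>n. S n \<in> borel_measurable \<mu>"
      by (intro haar_measurable borel_measurable_continuous_onI G contS)+
    show "AE Q in \<mu>. (\<lambda>n. S n Q) \<longlonglongrightarrow> G Q"
    proof (rule AE_I2)
      fix Q assume "Q \<in> space \<mu>"
      then have "((\<lambda>t. (F (rodrigues a (0 + t) ** Q) - F (rodrigues a 0 ** Q)) / t) \<longlongrightarrow>
          G (rodrigues a 0 ** Q)) (at 0)"
        using deriv[of Q 0] by (simp add: DERIV_def space_haar)
      moreover have "filterlim h (at 0) sequentially"
        unfolding filterlim_at using LIMSEQ_inverse_real_of_nat by (auto simp: h_def[abs_def])
      ultimately show "(\<lambda>n. S n Q) \<longlonglongrightarrow> G Q"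
        unfolding S_def using filterlim_compose by (fastforce simp: rot0)
    qed
    show "AE Q in \<mu>. norm (S n Q) \<le> B" for n
    proof (rule AE_I2)
      fix Q assume Q: "Q \<in> space \<mu>"
      then obtain z where "F (rodrigues a (h n) ** Q) - F (rodrigues a 0 ** Q)
          = (h n - 0) * G (rodrigues a z ** Q)"
        using MVT2[of 0 "h n" "\<lambda>t. F (rodrigues a t ** Q)" "\<lambda>t. G (rodrigues a t ** Q)"]
          h deriv by (auto simp: space_haar)
      then have "S n Q = G (rodrigues a z ** Q)" using h[of n] by (simp add: S_def rot0)
      then show "norm (S n Q) \<le> B"
        using Q B[of "rodrigues a z ** Q"] rodrigues_in_SO3[OF a] by (simp add: space_haar SO3_mult)
    qed
  qed simp
  moreover have "(\<integral>Q. S n Q \<partial>\<mu>) = 0" for n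
    unfolding S_def using haar_integrable contF F
      haar_integral_left_mult[OF rodrigues_in_SO3[OF a, of "h n"], of F]
    by (simp add: borel_measurable_continuous_onI)
  ultimately show ?thesis by (simp add: LIMSEQ_const_iff)
qed

text \<open>The invariance is applied to \<open>cos_angle Q ^ n * trace (hat a ** Q)\<close>, that is, to a power of the cosine times
  its own derivative (up to the factor 2) along the rotations about \<open>a\<close>.\<close>
lemma haar_axis_identity:
  assumes a: "norm a = 1"
  shows "(\<integral>Q. real n * cos_angle Q ^ (n - 1) * (trace (hat a ** Q))\<^sup>2 / 2
      + cos_angle Q ^ n * trace (hat a ** (hat a ** Q)) \<partial>\<mu>) = 0"
proof (rule haar_integral_derivative[OF a])
  let ?F = "\<lambda>Q. cos_angle Q ^ n * trace (hat a ** Q)"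
  show "continuous_on UNIV ?F" by (intro continuous_intros)
  show "continuous_on UNIV (\<lambda>Q. real n * cos_angle Q ^ (n - 1) * (trace (hat a ** Q))\<^sup>2 / 2
      + cos_angle Q ^ n * trace (hat a ** (hat a ** Q)))"
    by (intro continuous_intros) auto
  fix Q :: "real^3^3" and t
  let ?R = "\<lambda>t. rodrigues a t ** Q" and ?H = "hat a"
  have cube: "?H ** (?H ** (?H ** Q)) = - (?H ** Q)"
    using hat_cube[OF a] by (simp add: matrix_mul_assoc matrix_linear_left)
  have R: "?R t = Q + sin t *\<^sub>R (?H ** Q) + (1 - cos t) *\<^sub>R (?H ** (?H ** Q))" for t
    by (simp add: rodrigues_def matrix_linear_left matrix_mul_assoc)
  have d0: "((\<lambda>t. cos_angle (?R t)) has_real_derivative trace (?H ** ?R t) / 2) (at t)"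
    unfolding R cos_angle_def matrix_linear_right trace_linear cube
    by (auto intro!: derivative_eq_intros simp: algebra_simps)
  have d1: "((\<lambda>t. trace (?H ** ?R t)) has_real_derivative trace (?H ** (?H ** ?R t))) (at t)"
    unfolding R matrix_linear_right trace_linear cube
    by (auto intro!: derivative_eq_intros simp: algebra_simps)
  show "((\<lambda>t. ?F (?R t)) has_real_derivative
      real n * cos_angle (?R t) ^ (n - 1) * (trace (?H ** ?R t))\<^sup>2 / 2
      + cos_angle (?R t) ^ n * trace (?H ** (?H ** ?R t))) (at t)"
    by (rule derivative_eq_intros d0 d1 refl)+ (simp add: power2_eq_square)
qed

text \<open>Up to sign, the three traces are twice the entries of the skew part of \<open>Q\<close>, which is \<open>sin \<theta> *\<^sub>R hat a\<close> for a rotation by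
  \<open>\<theta>\<close> about \<open>a\<close>; their squares add up to four times the squared sine. Together with the next lemma
  this makes the sum of the axis identities a statement about the cosine of the angle only.\<close>
lemma sum_trace_hat_sq:
  assumes "Q \<in> SO3"
  shows "(\<Sum>i\<in>UNIV. (trace (hat (axis i 1) ** Q))\<^sup>2) = 4 * (1 - (cos_angle Q)\<^sup>2)"
proof -
  have row: "(Q ** transpose Q)$i$i = 1" for i
    using SO3_times_transpose[OF assms] by (simp add: mat_def)
  have "(\<Sum>i\<in>UNIV. (trace (hat (axis i 1) ** Q))\<^sup>2)
    = (Q ** transpose Q)$1$1 + (Q ** transpose Q)$2$2 + (Q ** transpose Q)$3$3 - (trace Q)\<^sup>2
      + 2 * ((Q$2$2 * Q$3$3 - Q$2$3 * Q$3$2) + (Q$1$1 * Q$3$3 - Q$1$3 * Q$3$1)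
      + (Q$1$1 * Q$2$2 - Q$1$2 * Q$2$1))"
    by (simp add: sum_3 trace_3 matrix_matrix_mult_def transpose_def hat_components axis_def
        power2_eq_square algebra_simps)
  also have "\<dots> = 3 - (trace Q)\<^sup>2 + 2 * trace Q"
    unfolding row SO3_minors[OF assms] by (simp add: trace_3)
  finally show ?thesis by (simp add: cos_angle_def power2_eq_square field_simps)
qed

lemma sum_trace_hat_hat:
  "(\<Sum>i\<in>UNIV. trace (hat (axis i 1) ** (hat (axis i 1) ** Q))) = - 2 * (1 + 2 * cos_angle Q)"
  by (simp add: sum_3 trace_3 matrix_matrix_mult_def hat_components axis_def cos_angle_def field_simps)

lemma haar_moment_recursion:
  "real (n + 2) * (\<integral>Q. cos_angle Q ^ Suc n \<partial>\<mu>)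
    = real n * (\<integral>Q. cos_angle Q ^ (n - 1) \<partial>\<mu>) - (\<integral>Q. cos_angle Q ^ n \<partial>\<mu>)"
proof -
  let ?c = cos_angle
  have int: "integrable \<mu> (\<lambda>Q. ?c Q ^ k)" for k
    by (intro haar_integrable continuous_intros)
  have "0 = (\<Sum>i\<in>UNIV. \<integral>Q. real n * ?c Q ^ (n - 1) * (trace (hat (axis i 1) ** Q))\<^sup>2 / 2
      + ?c Q ^ n * trace (hat (axis i 1) ** (hat (axis i 1) ** Q)) \<partial>\<mu>)"
    by (subst haar_axis_identity) simp_all
  also have "\<dots> = (\<integral>Q. (\<Sum>i\<in>UNIV. real n * ?c Q ^ (n - 1) * (trace (hat (axis i 1) ** Q))\<^sup>2 / 2
      + ?c Q ^ n * trace (hat (axis i 1) ** (hat (axis i 1) ** Q))) \<partial>\<mu>)"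
    by (intro Bochner_Integration.integral_sum[symmetric] haar_integrable continuous_intros) auto
  also have "\<dots> = (\<integral>Q. 2 * (real n * ?c Q ^ (n - 1)) - 2 * (?c Q ^ n) - 2 * (real (n + 2) * ?c Q ^ Suc n) \<partial>\<mu>)"
  proof (rule Bochner_Integration.integral_cong[OF refl])
    fix Q assume "Q \<in> space \<mu>"
    then have Q: "Q \<in> SO3" by (simp add: space_haar)
    have "(\<Sum>i\<in>UNIV. real n * ?c Q ^ (n - 1) * (trace (hat (axis i 1) ** Q))\<^sup>2 / 2
        + ?c Q ^ n * trace (hat (axis i 1) ** (hat (axis i 1) ** Q)))
      = real n * ?c Q ^ (n - 1) / 2 * (\<Sum>i\<in>UNIV. (trace (hat (axis i 1) ** Q))\<^sup>2)
        + ?c Q ^ n * (\<Sum>i\<in>UNIV. trace (hat (axis i 1) ** (hat (axis i 1) ** Q)))"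
      by (simp add: sum.distrib sum_distrib_left sum_divide_distrib)
    also have "\<dots> = 2 * (real n * ?c Q ^ (n - 1)) - 2 * (?c Q ^ n) - 2 * (real (n + 2) * ?c Q ^ Suc n)"
      unfolding sum_trace_hat_sq[OF Q] sum_trace_hat_hat
      by (cases n) (simp_all add: power2_eq_square field_simps)
    finally show "(\<Sum>i\<in>UNIV. real n * ?c Q ^ (n - 1) * (trace (hat (axis i 1) ** Q))\<^sup>2 / 2
        + ?c Q ^ n * trace (hat (axis i 1) ** (hat (axis i 1) ** Q))) = \<dots>" .
  qed
  also have "\<dots> = 2 * (real n * (\<integral>Q. ?c Q ^ (n - 1) \<partial>\<mu>)) - 2 * (\<integral>Q. ?c Q ^ n \<partial>\<mu>)
      - 2 * (real (n + 2) * (\<integral>Q. ?c Q ^ Suc n \<partial>\<mu>))"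
    using int by (simp del: power_Suc)
  finally show ?thesis by simp
qed

end

section \<open>The law of the rotation angle\<close>

text \<open>The law of the rotation angle of a uniformly distributed rotation.\<close>
definition angle_measure :: "real measure" where
  "angle_measure = density lborel (\<lambda>\<rho>. ennreal (indicator {0..pi} \<rho> * ((1 - cos \<rho>) / pi)))"

lemma angle_measure_integral:
  fixes g :: "real \<Rightarrow> real"
  assumes "g \<in> borel_measurable borel"
  shows "(\<integral>\<rho>. g \<rho> \<partial>angle_measure) = (LBINT \<rho>:{0..pi}. (1 - cos \<rho>) / pi * g \<rho>)"
  using assms unfolding angle_measure_def set_lebesgue_integral_def
  by (subst integral_density) (auto simp: mult_ac)

lemma angle_measure_integral_continuous:
  fixes g :: "real \<Rightarrow> real"
  assumes "continuous_on UNIV g"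
  shows "(\<integral>\<rho>. g \<rho> \<partial>angle_measure) = integral {0..pi} (\<lambda>\<rho>. (1 - cos \<rho>) * g \<rho>) / pi"
proof -
  have c: "continuous_on {0..pi} (\<lambda>\<rho>. (1 - cos \<rho>) / pi * g \<rho>)"
    by (intro continuous_intros continuous_on_subset[OF assms]) auto
  have "(\<integral>\<rho>. g \<rho> \<partial>angle_measure) = integral {0..pi} (\<lambda>\<rho>. (1 - cos \<rho>) / pi * g \<rho>)"
    using assms set_borel_integral_eq_integral(2)[OF borel_integrable_atLeastAtMost'[OF c]]
    by (simp add: angle_measure_integral borel_measurable_continuous_onI)
  then show ?thesis by simp
qed

lemma prob_space_angle_measure: "prob_space angle_measure"
proof
  have c: "continuous_on {0..pi} (\<lambda>\<rho>. (1 - cos \<rho>) / pi)"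
    by (intro continuous_intros) auto
  have "((\<lambda>\<rho>. (1 - cos \<rho>) / pi) has_integral ((pi - sin pi) / pi - (0 - sin 0) / pi)) {0..pi}"
    by (intro fundamental_theorem_of_calculus)
      (auto intro!: derivative_eq_intros simp flip: has_real_derivative_iff_has_vector_derivative)
  from integral_unique[OF this] have "(LBINT \<rho>:{0..pi}. (1 - cos \<rho>) / pi) = 1"
    using set_borel_integral_eq_integral(2)[OF borel_integrable_atLeastAtMost'[OF c]]
    by (simp del: integral_divide_zero)
  then show "emeasure angle_measure (space angle_measure) = 1"
    using borel_integrable_atLeastAtMost'[OF c]
    by (simp add: angle_measure_def emeasure_density nn_integral_eq_integral
        set_lebesgue_integral_def set_integrable_def)
qed

text \<open>Integration by parts: the difference of the two sides is, up to the factor \<open>pi\<close>, the integral of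
  the derivative of \<open>cos \<rho> ^ n * sin \<rho> * (1 - cos \<rho>)\<close>, which vanishes at 0 and at \<open>pi\<close>.\<close>
lemma angle_moment_recursion:
  "real (n + 2) * (\<integral>\<rho>. cos \<rho> ^ Suc n \<partial>angle_measure)
    = real n * (\<integral>\<rho>. cos \<rho> ^ (n - 1) \<partial>angle_measure) - (\<integral>\<rho>. cos \<rho> ^ n \<partial>angle_measure)"
proof -
  let ?I = "\<lambda>k. integral {0..pi} (\<lambda>\<rho>. (1 - cos \<rho>) * cos \<rho> ^ k)"
  have int: "(\<lambda>\<rho>. (1 - cos \<rho>) * cos \<rho> ^ k) integrable_on {0..pi}" for k
    by (intro integrable_continuous_real continuous_intros)
  let ?D = "\<lambda>\<rho>. real (n + 2) * ((1 - cos \<rho>) * cos \<rho> ^ Suc n) + (1 - cos \<rho>) * cos \<rho> ^ n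
      - real n * ((1 - cos \<rho>) * cos \<rho> ^ (n - 1))"
  have "(?D has_integral (cos pi ^ n * sin pi * (1 - cos pi) - cos 0 ^ n * sin 0 * (1 - cos 0))) {0..pi}"
  proof (rule fundamental_theorem_of_calculus)
    fix \<rho> :: real
    have s: "sin \<rho> * sin \<rho> = (1 - cos \<rho>) * (1 + cos \<rho>)"
      using sin_squared_eq[of \<rho>] by (simp add: power2_eq_square algebra_simps)
    have "((\<lambda>\<rho>. cos \<rho> ^ n * sin \<rho> * (1 - cos \<rho>)) has_real_derivative
        cos \<rho> ^ n * (cos \<rho> * (1 - cos \<rho>) + sin \<rho> * sin \<rho>)
        - real n * cos \<rho> ^ (n - 1) * (sin \<rho> * sin \<rho>) * (1 - cos \<rho>)) (at \<rho>)"
      by (auto intro!: derivative_eq_intros simp: algebra_simps)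
    also have "cos \<rho> ^ n * (cos \<rho> * (1 - cos \<rho>) + sin \<rho> * sin \<rho>)
        - real n * cos \<rho> ^ (n - 1) * (sin \<rho> * sin \<rho>) * (1 - cos \<rho>) = ?D \<rho>"
      unfolding s by (cases n) (simp_all add: algebra_simps)
    finally show "((\<lambda>\<rho>. cos \<rho> ^ n * sin \<rho> * (1 - cos \<rho>)) has_vector_derivative ?D \<rho>)
        (at \<rho> within {0..pi})"
      by (simp add: has_real_derivative_iff_has_vector_derivative has_vector_derivative_at_within)
  qed simp
  then have "integral {0..pi} ?D = 0" by (simp add: integral_unique)
  moreover have "integral {0..pi} ?D = real (n + 2) * ?I (Suc n) + ?I n - real n * ?I (n - 1)"
    by (intro integral_unique has_integral_diff has_integral_add has_integral_mult_right
        integrable_integral int)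
  moreover have "?I k = pi * (\<integral>\<rho>. cos \<rho> ^ k \<partial>angle_measure)" for k
    by (subst angle_measure_integral_continuous) (auto intro!: continuous_intros)
  ultimately have "pi * (real (n + 2) * (\<integral>\<rho>. cos \<rho> ^ Suc n \<partial>angle_measure)
      + (\<integral>\<rho>. cos \<rho> ^ n \<partial>angle_measure) - real n * (\<integral>\<rho>. cos \<rho> ^ (n - 1) \<partial>angle_measure)) = 0"
    by (simp only: distrib_left right_diff_distrib mult.left_commute)
  then show ?thesis by (simp del: power_Suc)
qed

text \<open>At \<open>n = 0\<close> the factor \<open>real n\<close> removes the term with \<open>n - 1\<close>, so that the zeroth moment alone
  starts the recursion.\<close>
lemma moment_recursion_unique:
  fixes m m' :: "nat \<Rightarrow> real"
  assumes "m 0 = m' 0"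
    and "\<And>n. real (n + 2) * m (Suc n) = real n * m (n - 1) - m n"
    and "\<And>n. real (n + 2) * m' (Suc n) = real n * m' (n - 1) - m' n"
  shows "m n = m' n"
proof (induction n rule: less_induct)
  case (less n)
  show ?case
  proof (cases n)
    case (Suc k)
    then have "real (k + 2) * m (Suc k) = real (k + 2) * m' (Suc k)"
      using less[of k] less[of "k - 1"] assms(2,3)[of k] by simp
    then show ?thesis using Suc by simp
  qed (simp add: assms)
qed

lemma (in prob_space) char_eq_moment_series:
  fixes X :: "'a \<Rightarrow> real"
  assumes X: "X \<in> borel_measurable M" "\<And>x. x \<in> space M \<Longrightarrow> \<bar>X x\<bar> \<le> 1"
  shows "(\<lambda>n. \<Sum>k\<le>n. (\<i> * t) ^ k / fact k * of_real (\<integral>x. X x ^ k \<partial>M))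
    \<longlonglongrightarrow> char (distr M borel X) t"
proof -
  have pow: "\<bar>X x\<bar> ^ k \<le> 1" if "x \<in> space M" for k x
    using X(2)[OF that] by (simp add: power_le_one)
  have int: "integrable M (\<lambda>x. X x ^ k)" "integrable M (\<lambda>x. \<bar>X x\<bar> ^ k)" for k
    using X pow by (auto intro!: integrable_const_bound[where B=1] AE_I2 simp: power_abs)
  have bound: "norm ((\<Sum>k\<le>n. (\<i> * t) ^ k / fact k * of_real (\<integral>x. X x ^ k \<partial>M))
      - char (distr M borel X) t) \<le> 2 * (inverse (fact n) * \<bar>t\<bar> ^ n)" for n
  proof -
    have "norm ((\<Sum>k\<le>n. (\<i> * t) ^ k / fact k * of_real (\<integral>x. X x ^ k \<partial>M))
        - char (distr M borel X) t) \<le> 2 * \<bar>t\<bar> ^ n / fact n * (\<integral>x. \<bar>X x\<bar> ^ n \<partial>M)"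
      using char_approx1'[of n X "distr M borel X" t] int X by (simp add: norm_minus_commute)
    also have "\<dots> \<le> 2 * \<bar>t\<bar> ^ n / fact n * 1"
      using integral_le_const[OF int(2) AE_I2, of n 1] pow by (intro mult_left_mono) simp_all
    finally show ?thesis by (simp add: divide_inverse mult_ac)
  qed
  have lim: "(\<lambda>n. 2 * (inverse (fact n) * \<bar>t\<bar> ^ n)) \<longlonglongrightarrow> 0"
    using tendsto_mult[OF tendsto_const summable_LIMSEQ_zero[OF summable_exp[of "\<bar>t\<bar>"]], of 2] by simp
  show ?thesis
    by (rule LIM_zero_cancel, rule Lim_null_comparison[OF always_eventually[OF allI[OF bound]] lim])
qed

text \<open>Bounded random variables are determined by their moments, because their characteristic functions are the
  sums of the corresponding power series.\<close>
lemma moments_determine_distribution: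
  fixes X :: "'a \<Rightarrow> real" and Y :: "'b \<Rightarrow> real"
  assumes "prob_space M" "prob_space N"
    and X: "X \<in> borel_measurable M" "\<And>x. x \<in> space M \<Longrightarrow> \<bar>X x\<bar> \<le> 1"
    and Y: "Y \<in> borel_measurable N" "\<And>y. y \<in> space N \<Longrightarrow> \<bar>Y y\<bar> \<le> 1"
    and moments: "\<And>n. (\<integral>x. X x ^ n \<partial>M) = (\<integral>y. Y y ^ n \<partial>N)"
  shows "distr M borel X = distr N borel Y"
proof -
  interpret M: prob_space M by fact
  interpret N: prob_space N by fact
  have "char (distr M borel X) = char (distr N borel Y)"
  proof
    fix t show "char (distr M borel X) t = char (distr N borel Y) t"
      using M.char_eq_moment_series[OF X, of t] N.char_eq_moment_series[OF Y, of t]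
      unfolding moments by (rule LIMSEQ_unique)
  qed
  then show ?thesis
    using X Y by (intro Levy_uniqueness M.real_distribution_distr N.real_distribution_distr)
qed

lemma haar_angle_distribution:
  assumes "haar_SO3 \<mu>"
  shows "distr \<mu> borel cos_angle = distr angle_measure borel cos"
proof (rule moments_determine_distribution)
  interpret prob_space \<mu> using assms by (rule haar_prob_space)
  interpret A: prob_space angle_measure by (rule prob_space_angle_measure)
  show "prob_space \<mu>" "prob_space angle_measure" by unfold_locales
  show "cos_angle \<in> borel_measurable \<mu>"
    by (intro haar_measurable[OF assms] borel_measurable_cos_angle)
  show "cos \<in> borel_measurable angle_measure" by (simp add: angle_measure_def)
  show "\<And>Q. Q \<in> space \<mu> \<Longrightarrow> \<bar>cos_angle Q\<bar> \<le> 1"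
    by (simp add: space_haar[OF assms] abs_cos_angle_le_1)
  show "(\<integral>Q. cos_angle Q ^ n \<partial>\<mu>) = (\<integral>\<rho>. cos \<rho> ^ n \<partial>angle_measure)" for n
  proof (rule moment_recursion_unique[where n=n])
    show "(\<integral>Q. cos_angle Q ^ 0 \<partial>\<mu>) = (\<integral>\<rho>. cos \<rho> ^ 0 \<partial>angle_measure)"
      by (simp add: prob_space A.prob_space)
  qed (rule haar_moment_recursion[OF assms] angle_moment_recursion)+
qed simp

lemma haar_integral_class_function:
  fixes g :: "real \<Rightarrow> real"
  assumes "haar_SO3 \<mu>" "g \<in> borel_measurable borel"
  shows "(\<integral>Q. g (cos_angle Q) \<partial>\<mu>) = (LBINT \<rho>:{0..pi}. (1 - cos \<rho>) / pi * g (cos \<rho>))"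
proof -
  have "(\<integral>Q. g (cos_angle Q) \<partial>\<mu>) = (\<integral>x. g x \<partial>distr \<mu> borel cos_angle)"
    by (intro integral_distr[symmetric] haar_measurable[OF assms(1)] borel_measurable_cos_angle assms)
  also have "\<dots> = (\<integral>\<rho>. g (cos \<rho>) \<partial>angle_measure)"
    unfolding haar_angle_distribution[OF assms(1)]
    by (intro integral_distr assms) (simp add: angle_measure_def)
  also have "\<dots> = (LBINT \<rho>:{0..pi}. (1 - cos \<rho>) / pi * g (cos \<rho>))"
    by (intro angle_measure_integral measurable_compose[OF _ assms(2)]) simp
  finally show ?thesis .
qed

text \<open>On \<open>[0, pi]\<close> the cosine is decreasing, so the event that the cosine is at least \<open>cos \<theta>\<close> is an
  initial interval of angles. The case \<open>\<theta> = pi\<close> gives integrals over the whole group.\<close>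
lemma haar_integral_cos_angle_ge:
  fixes g :: "real \<Rightarrow> real"
  assumes "haar_SO3 \<mu>" "continuous_on UNIV g" "0 \<le> \<theta>" "\<theta> \<le> pi"
  shows "(\<integral>Q. indicator {cos \<theta>..} (cos_angle Q) * g (cos_angle Q) \<partial>\<mu>)
    = integral {0..\<theta>} (\<lambda>\<rho>. g (cos \<rho>) * (1 - cos \<rho>)) / pi"
proof -
  have [measurable]: "g \<in> borel_measurable borel"
    using assms(2) by (rule borel_measurable_continuous_onI)
  have "(\<integral>Q. indicator {cos \<theta>..} (cos_angle Q) * g (cos_angle Q) \<partial>\<mu>)
    = (LBINT \<rho>:{0..pi}. (1 - cos \<rho>) / pi * (indicator {cos \<theta>..} (cos \<rho>) * g (cos \<rho>)))"
    by (rule haar_integral_class_function[OF assms(1)]) measurable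
  also have "\<dots> = (LBINT \<rho>:{0..\<theta>}. g (cos \<rho>) * (1 - cos \<rho>) / pi)"
    unfolding set_lebesgue_integral_def using assms(3,4)
    by (intro Bochner_Integration.integral_cong) (auto simp: indicator_def cos_mono_le_eq)
  also have "\<dots> = integral {0..\<theta>} (\<lambda>\<rho>. g (cos \<rho>) * (1 - cos \<rho>) / pi)"
    by (intro set_borel_integral_eq_integral borel_integrable_atLeastAtMost' continuous_intros
        continuous_on_compose2[OF assms(2)]) auto
  finally show ?thesis by simp
qed

section \<open>The isotropic matrix Fisher distribution\<close>

theorem mainTheorem4:
  fixes dR :: "(real^3^3) measure"
    and M :: "'w measure" and R :: "'w \<Rightarrow> real^3^3" and s :: real
  assumes "haar_SO3 dR"
    and "prob_space M"
    and "s \<ge> 0"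
    and "matrix_fisher M dR R (s *\<^sub>R mat 1)"
  shows "(\<forall>Q\<in>SO3. fisher_density dR (s *\<^sub>R mat 1) Q
            = 1 / (bessel_I0 (2 * s) - bessel_I1 (2 * s)) * exp (s * (trace Q - 1)))
       \<and> distributed M dR R (\<lambda>Q. ennreal
            (1 / (bessel_I0 (2 * s) - bessel_I1 (2 * s)) * exp (s * (trace Q - 1))))
       \<and> (\<forall>\<theta>\<in>{0..pi}.
            E_set \<theta> = {axis_rotation a \<rho> | a \<rho>. norm a = 1 \<and> 0 \<le> \<rho> \<and> \<rho> \<le> \<theta>}
          \<and> measure M {\<omega> \<in> space M. R \<omega> \<in> E_set \<theta>}
            = 1 / (pi * (bessel_I0 (2 * s) - bessel_I1 (2 * s)))
              * integral {0..\<theta>} (\<lambda>\<rho>. exp (2 * s * cos \<rho>) * (1 - cos \<rho>)))"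
proof -
  interpret M: prob_space M by fact
  interpret H: prob_space dR using assms(1) by (rule haar_prob_space)
  let ?Z = "bessel_I0 (2 * s) - bessel_I1 (2 * s)"
  let ?p = "\<lambda>Q :: real^3^3. 1 / ?Z * exp (s * (trace Q - 1))"
  have exponent: "trace (transpose (s *\<^sub>R mat 1) ** Q) = s + s * (trace Q - 1)" for Q :: "real^3^3"
    by (simp add: trace_3 matrix_matrix_mult_def transpose_def mat_def sum_3 algebra_simps)
  have trace_cos: "s * (trace Q - 1) = 2 * s * cos_angle Q" for Q
    by (simp add: cos_angle_def)

  have Z: "?Z = integral {0..pi} (\<lambda>\<rho>. exp (2 * s * cos \<rho>) * (1 - cos \<rho>)) / pi"
  proof -
    have "integral {0..pi} (\<lambda>\<rho>. exp (2 * s * cos \<rho>) * (1 - cos \<rho>))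
      = integral {0..pi} (\<lambda>\<rho>. exp (2 * s * cos \<rho>) - cos \<rho> * exp (2 * s * cos \<rho>))"
      by (simp add: algebra_simps)
    also have "\<dots> = integral {0..pi} (\<lambda>\<rho>. exp (2 * s * cos \<rho>))
        - integral {0..pi} (\<lambda>\<rho>. cos \<rho> * exp (2 * s * cos \<rho>))"
      by (intro Henstock_Kurzweil_Integration.integral_diff integrable_continuous_real continuous_intros)
    finally show ?thesis by (simp add: bessel_I0_def bessel_I1_def diff_divide_distrib)
  qed
  have "fisher_const dR (s *\<^sub>R mat 1) = (\<integral>Q. exp s * exp (2 * s * cos_angle Q) \<partial>dR)"
    by (simp add: fisher_const_def exponent trace_cos exp_add)
  also have "\<dots> = exp s * (\<integral>Q. exp (2 * s * cos_angle Q) \<partial>dR)" by simp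
  \<comment> \<open>The indicator is 1 throughout, since \<open>cos pi = -1\<close>.\<close>
  also have "(\<integral>Q. exp (2 * s * cos_angle Q) \<partial>dR)
    = (\<integral>Q. indicator {cos pi..} (cos_angle Q) * exp (2 * s * cos_angle Q) \<partial>dR)"
    using abs_cos_angle_le_1
    by (intro Bochner_Integration.integral_cong) (force simp: space_haar[OF assms(1)] indicator_def abs_le_iff)+
  also have "\<dots> = ?Z"
    unfolding Z by (intro haar_integral_cos_angle_ge assms continuous_intros) auto
  finally have const: "fisher_const dR (s *\<^sub>R mat 1) = exp s * ?Z" .
  have density: "fisher_density dR (s *\<^sub>R mat 1) Q = ?p Q" for Q
    by (simp add: fisher_density_def const exponent exp_add)
  have dist: "distributed M dR R (\<lambda>Q. ennreal (?p Q))"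
    using assms(4) by (simp add: matrix_fisher_def density)

  have Z_nonneg: "0 \<le> ?Z"
    unfolding Z by (intro divide_nonneg_pos Henstock_Kurzweil_Integration.integral_nonneg
        integrable_continuous_real continuous_intros) auto
  have prob: "measure M {\<omega> \<in> space M. R \<omega> \<in> E_set \<theta>}
      = 1 / (pi * ?Z) * integral {0..\<theta>} (\<lambda>\<rho>. exp (2 * s * cos \<rho>) * (1 - cos \<rho>))"
    if \<theta>: "0 \<le> \<theta>" "\<theta> \<le> pi" for \<theta>
  proof -
    let ?i = "\<lambda>Q. indicator {cos \<theta>..} (cos_angle Q) :: real"
    have R: "R \<in> measurable M dR" using dist by (rule distributed_measurable)
    have i: "?i \<in> borel_measurable dR"
      by (intro haar_measurable[OF assms(1)]) measurable
    have E: "R \<omega> \<in> E_set \<theta> \<longleftrightarrow> cos \<theta> \<le> cos_angle (R \<omega>)" if "\<omega> \<in> space M" for \<omega>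
      using measurable_space[OF R that] E_set_iff_cos_angle[OF \<theta>] by (simp add: space_haar[OF assms(1)])
    have "measure M {\<omega> \<in> space M. R \<omega> \<in> E_set \<theta>}
        = (\<integral>\<omega>. indicator {\<omega> \<in> space M. R \<omega> \<in> E_set \<theta>} \<omega> \<partial>M)"
      by (simp add: Int_def conj_commute)
    also have "\<dots> = (\<integral>\<omega>. ?i (R \<omega>) \<partial>M)"
      using E by (intro Bochner_Integration.integral_cong) (auto simp: indicator_def)
    also have "\<dots> = (\<integral>Q. ?p Q * ?i Q \<partial>dR)"
      using Z_nonneg by (intro distributed_integral[OF dist i, symmetric]) auto
    also have "\<dots> = (\<integral>Q. ?i Q * (1 / ?Z * exp (2 * s * cos_angle Q)) \<partial>dR)"
      by (simp add: trace_cos mult_ac)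
    also have "\<dots> = integral {0..\<theta>} (\<lambda>\<rho>. 1 / ?Z * exp (2 * s * cos \<rho>) * (1 - cos \<rho>)) / pi"
      using \<theta> by (intro haar_integral_cos_angle_ge assms continuous_intros) auto
    finally show ?thesis by (simp add: mult.assoc)
  qed
  show ?thesis using density dist prob E_set_eq_axis_rotations by auto
qed

end
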